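(* Let $q>0$ be a real number. For every integer $m\ge 0$ and every $z\in\mathbb{C}$, $$B_q(\psi_m)(z)=\frac{z^m}{\sqrt{\Gamma(qm+1)}}.$$ Moreover, $$\|B_q(\psi_m)\|_{ML_q(\mathbb{C})}=1=\|\psi_m\|_{L^2(\mathbb{R})}.$$
   Context: $L^2(\mathbb{R})$ is the space of complex-valued square integrable functions on $\mathbb{R}$, with inner product $\langle\phi,\psi\rangle_{L^2(\mathbb{R})}=\int_{\mathbb{R}}\phi(t)\overline{\psi(t)}\,dt$. The normalized Hermite functions $\psi_n$, $n\ge 0$, are $\psi_n(x)=(2^n n!\sqrt{\pi})^{-1/2}H_n(x)e^{-x^2/2}$ with $H_n$ the (physicists') Hermite polynomials; they form an orthonormal basis of $L^2(\mathbb{R})$. For $q>0$ the Mittag-Leffler Fock space $ML_q(\mathbb{C})$ is the Hilbert space of entire functions $f$ with $$\|f\|^2_{ML_q(\mathbb{C})}=\frac{1}{q\pi}\int_{\mathbb{C}}|f(z)|^2|z|^{\frac{2}{q}-2}e^{-|z|^{2/q}}\,dA(z)<\infty,$$ where $dA(z)=dx\,dy$ for $z=x+iy$. The ML-Bargmann kernel is $$A_q(z,x)=\sum_{n=0}^\infty\frac{\overline{z}^{\,n}}{\sqrt{\Gamma(qn+1)}}\psi_n(x),\qquad z\in\mathbb{C},\ x\in\mathbb{R},$$ and the Mittag-Leffler Bargmann (MLB) transform of $\phi\in L^2(\mathbb{R})$ is $$B_q(\phi)(z)=\int_{\mathbb{R}}\overline{A_q(z,x)}\,\phi(x)\,dx,\qquad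 z\in\mathbb{C}.$$ *)

theory Defs
  imports "HOL-Analysis.Analysis"
begin

(* Physicists' normalisation, by the Rodrigues formula. *)
definition hermite :: "nat \<Rightarrow> real \<Rightarrow> real" where
  "hermite n x = (-1) ^ n * exp (x\<^sup>2) * (deriv ^^ n) (\<lambda>t. exp (- t\<^sup>2)) x"

definition hermite_fn :: "nat \<Rightarrow> real \<Rightarrow> complex" where
  "hermite_fn n x =
     complex_of_real ((2 ^ n * fact n * sqrt pi) powr (- 1 / 2) * hermite n x * exp (- x\<^sup>2 / 2))"

(* Elements are representatives: functions are not identified up to null sets. *)
definition L2_space :: "(real \<Rightarrow> complex) set" where
  "L2_space = {\<phi>. \<phi> \<in> borel_measurable lebesgue \<and> integrable lebesgue (\<lambda>t. (cmod (\<phi> t))\<^sup>2)}"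

definition L2_inner :: "(real \<Rightarrow> complex) \<Rightarrow> (real \<Rightarrow> complex) \<Rightarrow> complex" where
  "L2_inner \<phi> \<psi> = (LINT t|lebesgue. \<phi> t * cnj (\<psi> t))"

(* The inner product of a function with itself is real, so Re only changes the type. *)
definition L2_norm :: "(real \<Rightarrow> complex) \<Rightarrow> real" where
  "L2_norm \<phi> = sqrt (Re (L2_inner \<phi> \<phi>))"

(* At z = 0 the weight takes the value 0, as 0 powr a = 0 for every a; this is a null set. *)
definition MLF_weight :: "real \<Rightarrow> complex \<Rightarrow> real" where
  "MLF_weight q z = cmod z powr (2 / q - 2) * exp (- (cmod z powr (2 / q)))"

definition MLF_space :: "real \<Rightarrow> (complex \<Rightarrow> complex) set" where
  "MLF_space q = {f. f holomorphic_on UNIV \<and>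
     integrable lebesgue (\<lambda>z. (cmod (f z))\<^sup>2 * MLF_weight q z)}"

definition MLF_norm :: "real \<Rightarrow> (complex \<Rightarrow> complex) \<Rightarrow> real" where
  "MLF_norm q f =
     sqrt (1 / (q * pi) * (LINT z|lebesgue. (cmod (f z))\<^sup>2 * MLF_weight q z))"

definition MLB_kernel :: "real \<Rightarrow> complex \<Rightarrow> real \<Rightarrow> complex" where
  "MLB_kernel q z x =
     (\<Sum>n. cnj z ^ n / complex_of_real (sqrt (Gamma (q * real n + 1))) * hermite_fn n x)"

definition MLB_transform :: "real \<Rightarrow> (real \<Rightarrow> complex) \<Rightarrow> complex \<Rightarrow> complex" where
  "MLB_transform q \<phi> z = (LINT x|lebesgue. cnj (MLB_kernel q z x) * \<phi> x)"

end

theory Submission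
  imports Defs "HOL-Probability.Distributions" "HOL-Real_Asymp.Real_Asymp"
begin

text \<open>Integrating by parts against the Gaussian weight lowers both indices of
  $\int H_{m+1} H_{n+1} e^{-x^2}\,dx$ at the cost of a factor $2(m+1)$, because $H_{m+1}' = 2(m+1) H_m$
  and $(H_n e^{-x^2})' = -H_{n+1} e^{-x^2}$; this gives orthonormality of the Hermite functions.
  The kernel series may be integrated term by term since
  $\int |\psi_n \psi_m| \le \int (\psi_n^2 + \psi_m^2)/2 = 1$ and $1/\sqrt{\Gamma(qn+1)}$ decays faster
  than any geometric sequence, so only the $m$-th term survives.  For the norm of the monomial, the image
  of the area measure under $z \mapsto |z|^{2/q}$ has density $q\pi t^{q-1}$ on $t \ge 0$, which turns
  the weighted integral into a Gamma integral.\<close>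

section \<open>Polynomials against the Gaussian weight: integrability, decay, integration by
  parts\<close>

lemma integrable_poly_gauss:
  fixes p :: "real poly"
  shows "integrable lborel (\<lambda>x. poly p x * exp (- x\<^sup>2))"
proof -
  have even: "integrable lborel (\<lambda>x::real. exp (- x\<^sup>2) * x ^ (2 * k))" for k
    using has_bochner_integral_even_function[OF gaussian_moment_even_pos[of k]]
    by (auto simp: has_bochner_integral_iff)
  have mono: "integrable lborel (\<lambda>x::real. x ^ k * exp (- x\<^sup>2))" for k
  proof (rule Bochner_Integration.integrable_bound)
    show "integrable lborel (\<lambda>x::real. exp (- x\<^sup>2) * x ^ (2 * 0) + exp (- x\<^sup>2) * x ^ (2 * k))"
      by (intro Bochner_Integration.integrable_add even)
    \<comment> \<open>The moments in \<open>even\<close> have even exponent only. With y = x^k this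
      bound dominates every monomial by the even moments 0 and 2k.\<close>
    have bd: "\<bar>y\<bar> \<le> 1 + y\<^sup>2" for y :: real
      using zero_le_power2[of "\<bar>y\<bar> - 1/2"] by (simp add: power2_eq_square algebra_simps)
    show "AE x::real in lborel. norm (x ^ k * exp (- x\<^sup>2)) \<le>
        norm (exp (- x\<^sup>2) * x ^ (2 * 0) + exp (- x\<^sup>2) * x ^ (2 * k))"
    proof (rule AE_I2)
      fix x :: real
      have "\<bar>x ^ k\<bar> * exp (- x\<^sup>2) \<le> (1 + (x ^ k)\<^sup>2) * exp (- x\<^sup>2)"
        by (intro mult_right_mono bd) auto
      also have "\<dots> = exp (- x\<^sup>2) * x ^ (2 * 0) + exp (- x\<^sup>2) * x ^ (2 * k)"
        by (simp add: algebra_simps power_mult[symmetric])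
      finally show "norm (x ^ k * exp (- x\<^sup>2)) \<le>
          norm (exp (- x\<^sup>2) * x ^ (2 * 0) + exp (- x\<^sup>2) * x ^ (2 * k))"
        by (simp add: abs_mult)
    qed
  qed auto
  show ?thesis
    by (simp add: poly_altdef sum_distrib_right mult.assoc mono)
qed

lemma tendsto_poly_gauss:
  fixes p :: "real poly"
  shows "((\<lambda>x. poly p x * exp (- x\<^sup>2)) \<longlongrightarrow> 0) at_top"
    and "((\<lambda>x. poly p x * exp (- x\<^sup>2)) \<longlongrightarrow> 0) at_bot"
proof -
  have *: "((\<lambda>x. poly p x * exp (- x\<^sup>2)) \<longlongrightarrow> 0) at_top" for p :: "real poly"
  proof -
    have "((\<lambda>x::real. x ^ i * exp (- x\<^sup>2)) \<longlongrightarrow> 0) at_top" for i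
      by real_asymp
    then have "((\<lambda>x. \<Sum>i\<le>degree p. coeff p i * (x ^ i * exp (- x\<^sup>2))) \<longlongrightarrow>
        (\<Sum>i\<le>degree p. coeff p i * 0)) at_top"
      by (intro tendsto_intros)
    then show ?thesis
      by (simp add: poly_altdef sum_distrib_right mult.assoc)
  qed
  show "((\<lambda>x. poly p x * exp (- x\<^sup>2)) \<longlongrightarrow> 0) at_top" by (rule *)
  show "((\<lambda>x. poly p x * exp (- x\<^sup>2)) \<longlongrightarrow> 0) at_bot"
    \<comment> \<open>The weight is even, so reflecting the line only replaces p(x) by
      p(-x).\<close>
    using *[of "pcompose p [:0, -1:]"]
    by (simp add: filterlim_at_bot_mirror poly_pcompose)
qed

lemma has_field_derivative_poly_gauss:
  "((\<lambda>x. poly p x * exp (- x\<^sup>2)) has_field_derivative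
     poly (pderiv p - [:0, 2:] * p) x * exp (- x\<^sup>2)) (at x)" for x :: real
  by (auto intro!: derivative_eq_intros simp: algebra_simps)

text \<open>Fundamental theorem of calculus on the whole line: the integrand is the derivative of
  p(x) exp(-x^2), which tends to 0 at both ends.\<close>

lemma integral_deriv_poly_gauss:
  fixes p :: "real poly"
  shows "(LINT x|lborel. poly (pderiv p - [:0, 2:] * p) x * exp (- x\<^sup>2)) = 0"
proof -
  have "(LBINT x=-\<infinity>..\<infinity>. poly (pderiv p - [:0, 2:] * p) x * exp (- x\<^sup>2)) = 0 - 0"
  proof (rule interval_integral_FTC_integrable[where F = "\<lambda>x. poly p x * exp (- x\<^sup>2)"])
    show "((\<lambda>x. poly p x * exp (- x\<^sup>2)) has_vector_derivative
        poly (pderiv p - [:0, 2:] * p) x * exp (- x\<^sup>2)) (at x)" for x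
      using has_field_derivative_poly_gauss has_real_derivative_iff_has_vector_derivative by blast
    show "set_integrable lborel (einterval (-\<infinity>) \<infinity>)
        (\<lambda>x. poly (pderiv p - [:0, 2:] * p) x * exp (- x\<^sup>2))"
      using integrable_poly_gauss[of "pderiv p - [:0, 2:] * p"]
      by (simp add: set_integrable_def del: poly_diff poly_mult)
  qed (use tendsto_poly_gauss in \<open>auto intro!: continuous_intros simp: ereal_tendsto_simps\<close>)
  then show ?thesis
    by (simp add: interval_lebesgue_integral_def set_lebesgue_integral_def)
qed

section \<open>Hermite polynomials and orthonormality of the Hermite functions\<close>

primrec hermite_poly :: "nat \<Rightarrow> real poly" where
  "hermite_poly 0 = 1"
| "hermite_poly (Suc n) = [:0, 2:] * hermite_poly n - pderiv (hermite_poly n)"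

text \<open>Differentiating p(x) exp(-x^2) replaces p by p' - 2xp, which is the negative of the
  recursion step of \<open>hermite_poly\<close>. The signs accumulate to (-1)^n and cancel against
  the factor in the Rodrigues formula.\<close>

lemma hermite_eq_poly: "hermite n x = poly (hermite_poly n) x"
proof -
  have "(deriv ^^ n) (\<lambda>t. exp (- t\<^sup>2)) = (\<lambda>x. (-1) ^ n * (poly (hermite_poly n) x * exp (- x\<^sup>2)))"
  proof (induction n)
    case (Suc n)
    show ?case
    proof
      fix x
      have "((\<lambda>x. (-1) ^ n * (poly (hermite_poly n) x * exp (- x\<^sup>2))) has_field_derivative
         (-1) ^ n * (poly (pderiv (hermite_poly n) - [:0, 2:] * hermite_poly n) x * exp (- x\<^sup>2))) (at x)"
        by (intro DERIV_cmult has_field_derivative_poly_gauss)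
      then show "(deriv ^^ Suc n) (\<lambda>t. exp (- t\<^sup>2)) x =
          (-1) ^ Suc n * (poly (hermite_poly (Suc n)) x * exp (- x\<^sup>2))"
        by (simp add: Suc.IH DERIV_imp_deriv) (simp add: algebra_simps)
    qed
  qed simp
  then show ?thesis
    by (simp add: hermite_def exp_minus field_simps flip: power_mult_distrib)
qed

text \<open>Differentiating the recursion gives H_{n+2}' = 2 H_{n+1} + 2x H_{n+1}' - H_{n+1}''. By
  the induction hypothesis the last two terms are 2(n+1)(2x H_n - H_n'), which the recursion
  recognises as 2(n+1) H_{n+1}.\<close>

lemma pderiv_hermite_poly: "pderiv (hermite_poly (Suc n)) = of_nat (2 * Suc n) * hermite_poly n"
proof (induction n)
  case 0
  show ?case by (simp add: pderiv_pCons numeral_poly)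
next
  case (Suc n)
  have pderiv_of_nat_mult: "pderiv (of_nat k * p) = of_nat k * pderiv p" for k and p :: "real poly"
    by (simp add: pderiv_mult)
  have two: "[:2:] = (2 :: real poly)"
    by (rule numeral_poly[symmetric])
  have "pderiv (hermite_poly (Suc (Suc n))) =
      2 * hermite_poly (Suc n) + [:0, 2:] * pderiv (hermite_poly (Suc n))
        - pderiv (pderiv (hermite_poly (Suc n)))"
    by (subst hermite_poly.simps(2))
       (simp add: pderiv_diff pderiv_mult pderiv_pCons two del: hermite_poly.simps(2))
  also have "\<dots> = 2 * hermite_poly (Suc n) + of_nat (2 * Suc n) * 
      ([:0, 2:] * hermite_poly n - pderiv (hermite_poly n))"
    unfolding Suc.IH pderiv_of_nat_mult by (simp add: algebra_simps del: hermite_poly.simps)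
  finally show ?case by (simp add: algebra_simps)
qed

text \<open>Integration by parts: for the product p H_n the weighted derivative p' - 2xp becomes p'
  H_n - p H_{n+1}, and its integral is zero.\<close>

lemma integral_hermite_poly_Suc:
  "(LINT x|lborel. poly (p * hermite_poly (Suc n)) x * exp (- x\<^sup>2)) =
   (LINT x|lborel. poly (pderiv p * hermite_poly n) x * exp (- x\<^sup>2))"
proof -
  have "0 = (LINT x|lborel. poly (pderiv p * hermite_poly n) x * exp (- x\<^sup>2)
      - poly (p * hermite_poly (Suc n)) x * exp (- x\<^sup>2))"
    using integral_deriv_poly_gauss[of "p * hermite_poly n"]
    by (simp add: pderiv_mult algebra_simps)
  also have "\<dots> = (LINT x|lborel. poly (pderiv p * hermite_poly n) x * exp (- x\<^sup>2))
      - (LINT x|lborel. poly (p * hermite_poly (Suc n)) x * exp (- x\<^sup>2))"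
    by (intro Bochner_Integration.integral_diff integrable_poly_gauss)
  finally show ?thesis by simp
qed

lemma integral_hermite_poly_mult:
  "(LINT x|lborel. poly (hermite_poly m * hermite_poly n) x * exp (- x\<^sup>2)) =
   (if m = n then 2 ^ n * fact n * sqrt pi else 0)"
\<comment> \<open>This rule lowers both indices together, as the integration by parts does. If
  exactly one index is 0, taking p = 1 leaves the integral of a zero derivative; if both are 0, it
  is the Gaussian integral.\<close>
proof (induction m n rule: diff_induct)
  case (1 m)
  show ?case
  proof (cases m)
    case 0
    then show ?thesis
      using has_bochner_integral_even_function[OF gaussian_moment_0]
      by (simp add: has_bochner_integral_iff)
  next
    case (Suc k)
    then show ?thesis
      using integral_hermite_poly_Suc[of 1 k] by (simp add: mult.commute del: hermite_poly.simps(2))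
  qed
next
  case (2 n)
  then show ?case
    using integral_hermite_poly_Suc[of 1 n] by (simp del: hermite_poly.simps(2))
next
  case (3 m n)
  have "(LINT x|lborel. poly (hermite_poly (Suc m) * hermite_poly (Suc n)) x * exp (- x\<^sup>2)) =
      (LINT x|lborel. of_nat (2 * Suc m) * (poly (hermite_poly m * hermite_poly n) x * exp (- x\<^sup>2)))"
    unfolding integral_hermite_poly_Suc pderiv_hermite_poly by (simp add: mult.assoc)
  with 3 show ?case
    by simp
qed

text \<open>Keeps orthonormality and the absolute value estimates over the reals;
  \<open>hermite_fn\<close> is recovered by embedding.\<close>

definition real_hermite_fn :: "nat \<Rightarrow> real \<Rightarrow> real" where
  "real_hermite_fn n x = (2 ^ n * fact n * sqrt pi) powr (- 1 / 2) * hermite n x * exp (- x\<^sup>2 / 2)"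

lemma hermite_fn_eq: "hermite_fn n x = complex_of_real (real_hermite_fn n x)"
  by (simp add: hermite_fn_def real_hermite_fn_def)

lemma real_hermite_fn_measurable [measurable]: "real_hermite_fn n \<in> borel_measurable borel"
proof -
  have "continuous_on UNIV (real_hermite_fn n)"
    unfolding real_hermite_fn_def hermite_eq_poly by (intro continuous_intros) auto
  then show ?thesis by (rule borel_measurable_continuous_onI)
qed

lemma real_hermite_fn_orthonormal:
  "has_bochner_integral lborel (\<lambda>x. real_hermite_fn m x * real_hermite_fn n x) (if m = n then 1 else 0)"
proof -
  define c where "c n = (2 ^ n * fact n * sqrt pi) powr (- 1 / 2)" for n :: nat
  have c: "c n * c n * (2 ^ n * fact n * sqrt pi) = 1" for n
  proof -
    have "0 < 2 ^ n * fact n * sqrt pi" by simp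
    then show ?thesis
      unfolding c_def by (simp only: powr_add[symmetric]) (simp add: powr_minus field_simps)
  qed
  have eq: "real_hermite_fn m x * real_hermite_fn n x =
      c m * c n * (poly (hermite_poly m * hermite_poly n) x * exp (- x\<^sup>2))" for x
  proof -
    have "exp (- x\<^sup>2) = exp (- x\<^sup>2 / 2) * exp (- x\<^sup>2 / 2)"
      by (simp flip: exp_add)
    then show ?thesis
      by (simp add: real_hermite_fn_def hermite_eq_poly c_def)
  qed
  show ?thesis
    unfolding eq has_bochner_integral_iff
    using integrable_poly_gauss[of "hermite_poly m * hermite_poly n"] c[of n]
      integral_hermite_poly_mult[of m n]
    by (auto simp del: poly_mult)
qed


section \<open>Growth of the Gamma function and convergence of the coefficient series\<close>

lemma Gamma_plus1_ge:
  fixes s R :: real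
  assumes "s \<ge> 0" "R \<ge> 0"
  shows "R powr s * exp (- R) \<le> Gamma (s + 1)"
proof -
  \<comment> \<open>For t \<ge> R the Gamma integrand t^s exp(-t) dominates R^s exp(-t), and exp(-t)
    integrates to exp(-R) over that tail. On [0, R) the minorant is set to 0.\<close>
  have "((\<lambda>t. R powr s * exp (- 1 * t)) has_integral R powr s * (exp (- 1 * R) / 1)) {R..}"
    by (intro has_integral_mult_right has_integral_exp_minus_to_infinity) simp
  then have "((\<lambda>t. if t \<in> {R..} then R powr s * exp (- 1 * t) else 0) has_integral
      R powr s * (exp (- 1 * R) / 1)) {0..}"
    using assms by (subst has_integral_restrict) auto
  moreover have "((\<lambda>t. t powr s / exp t) has_integral Gamma (s + 1)) {0..}"
    using Gamma_integral_real[of "s + 1"] assms by simp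
  ultimately have "R powr s * (exp (- 1 * R) / 1) \<le> Gamma (s + 1)"
    by (rule has_integral_le)
       (use assms in \<open>auto simp: exp_minus divide_inverse intro!: mult_right_mono powr_mono2\<close>)
  then show ?thesis by simp
qed

lemma summable_power_over_sqrt_Gamma:
  fixes q r :: real
  assumes "q > 0" "r \<ge> 0"
  shows "summable (\<lambda>n. r ^ n / sqrt (Gamma (q * real n + 1)))"
proof -
  \<comment> \<open>This choice gives R^(qn) = (2(r+1))^(2n), so the square root of the Gamma lower
    bound is a constant times (2(r+1))^n and the ratio r/(2(r+1)) is at most 1/2. The shift r+1
    keeps the base positive when r = 0.\<close>
  define R where "R = (2 * (r + 1)) powr (2 / q)"
  have "R > 0"
    using assms by (simp add: R_def)
  have le: "r ^ n / sqrt (Gamma (q * real n + 1)) \<le> exp (R / 2) * (1 / 2) ^ n" for n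
  proof -
    have "R powr (q * real n) = (2 * (r + 1)) powr (2 * real n)"
      using assms by (simp add: R_def powr_powr)
    also have "\<dots> = (2 * (r + 1)) powr real (2 * n)"
      by simp
    also have "\<dots> = (2 * (r + 1)) ^ (2 * n)"
      using assms by (subst powr_realpow) auto
    also have "\<dots> = ((2 * (r + 1)) ^ n)\<^sup>2"
      by (simp add: power_mult[symmetric] mult.commute)
    finally have "((2 * (r + 1)) ^ n * exp (- R / 2))\<^sup>2 = R powr (q * real n) * exp (- R)"
      by (simp add: power_mult_distrib flip: exp_double)
    also have "\<dots> \<le> Gamma (q * real n + 1)"
      using assms \<open>R > 0\<close> by (intro Gamma_plus1_ge) auto
    finally have "(2 * (r + 1)) ^ n * exp (- R / 2) \<le> sqrt (Gamma (q * real n + 1))"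
      by (rule real_le_rsqrt)
    then have "r ^ n / sqrt (Gamma (q * real n + 1)) \<le> r ^ n / ((2 * (r + 1)) ^ n * exp (- R / 2))"
      using assms by (intro divide_left_mono) (auto intro!: mult_pos_pos Gamma_real_pos add_nonneg_pos)
    also have "\<dots> = exp (R / 2) * (r / (2 * (r + 1))) ^ n"
      by (simp add: power_divide exp_minus field_simps)
    also have "\<dots> \<le> exp (R / 2) * (1 / 2) ^ n"
      using assms by (intro mult_left_mono power_mono) (auto simp: field_simps)
    finally show ?thesis .
  qed
  show ?thesis
  proof (rule summable_comparison_test')
    show "summable (\<lambda>n. exp (R / 2) * (1 / 2) ^ n)"
      by (intro summable_mult summable_geometric) simp
    show "norm (r ^ n / sqrt (Gamma (q * real n + 1))) \<le> exp (R / 2) * (1 / 2) ^ n" for n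
    proof -
      have "Gamma (q * real n + 1) > 0"
        using assms by (intro Gamma_real_pos add_nonneg_pos) auto
      then show ?thesis
        using le[of n] assms by simp
    qed
  qed
qed

section \<open>Term-by-term integration of the kernel series\<close>

lemma AE_summable_norm:
  fixes f :: "nat \<Rightarrow> 'a \<Rightarrow> 'b::{banach, second_countable_topology}"
  assumes int: "\<And>i. integrable M (f i)"
    and sum: "summable (\<lambda>i. \<integral>x. norm (f i x) \<partial>M)"
  shows "AE x in M. summable (\<lambda>i. norm (f i x))"
proof -
  note [measurable] = borel_measurable_integrable[OF int]
  \<comment> \<open>Tonelli for nonnegative series: the sum of the norms has finite integral, hence
    is finite almost everywhere.\<close>
  have "(\<integral>\<^sup>+x. (\<Sum>i. ennreal (norm (f i x))) \<partial>M) = (\<Sum>i. \<integral>\<^sup>+x. ennreal (norm (f i x)) \<partial>M)"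
    by (intro nn_integral_suminf) auto
  also have "\<dots> = (\<Sum>i. ennreal (\<integral>x. norm (f i x) \<partial>M))"
    by (intro arg_cong[where f = suminf] ext nn_integral_eq_integral integrable_norm int) auto
  also have "\<dots> \<noteq> \<infinity>"
    using sum by (simp add: ennreal_suminf_neq_top)
  finally have "AE x in M. (\<Sum>i. ennreal (norm (f i x))) \<noteq> \<infinity>"
    by (intro nn_integral_noteq_infinite) auto
  then show ?thesis
    by eventually_elim (auto intro: summable_suminf_not_top)
qed

text \<open>The bound is uniform in n, so summability of the integrated terms depends on the kernel
  coefficients alone.\<close>

lemma integral_abs_real_hermite_fn_mult_le:
  "(LINT x|lborel. \<bar>real_hermite_fn n x * real_hermite_fn m x\<bar>) \<le> 1"
proof -
  note ortho = real_hermite_fn_orthonormal[unfolded has_bochner_integral_iff]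
  have "(LINT x|lborel. \<bar>real_hermite_fn n x * real_hermite_fn m x\<bar>) \<le>
      (LINT x|lborel. (real_hermite_fn n x * real_hermite_fn n x
        + real_hermite_fn m x * real_hermite_fn m x) / 2)"
  proof (rule integral_mono)
    fix x
    have "2 * \<bar>real_hermite_fn n x\<bar> * \<bar>real_hermite_fn m x\<bar> \<le>
        \<bar>real_hermite_fn n x\<bar>\<^sup>2 + \<bar>real_hermite_fn m x\<bar>\<^sup>2"
      by (rule sum_squares_bound)
    then show "\<bar>real_hermite_fn n x * real_hermite_fn m x\<bar> \<le>
        (real_hermite_fn n x * real_hermite_fn n x + real_hermite_fn m x * real_hermite_fn m x) / 2"
      by (simp add: abs_mult power2_eq_square)
  qed (use ortho in auto)
  also have "\<dots> = 1"
    using ortho by simp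
  finally show ?thesis .
qed

lemma MLB_transform_hermite_fn:
  assumes "q > 0"
  shows "MLB_transform q (hermite_fn m) z = z ^ m / complex_of_real (sqrt (Gamma (q * real m + 1)))"
proof -
  \<comment> \<open>The transform conjugates the kernel, so \<open>c\<close> carries powers of z
    rather than of \<open>cnj z\<close>; the Hermite functions are real and unaffected.\<close>
  define c where "c n = z ^ n / complex_of_real (sqrt (Gamma (q * real n + 1)))" for n
  define f where "f n x = c n * complex_of_real (real_hermite_fn n x * real_hermite_fn m x)" for n x
  have f: "has_bochner_integral lborel (f n) (c n * complex_of_real (if n = m then 1 else 0))" for n
    unfolding f_def
    by (intro has_bochner_integral_mult_right has_bochner_integral_of_real real_hermite_fn_orthonormal)
  then have int_f: "integrable lborel (f n)" for n
    by (simp add: has_bochner_integral_iff)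
  have norm_c: "norm (c n) = norm z ^ n / sqrt (Gamma (q * real n + 1))" for n
  proof -
    have "Gamma (q * real n + 1) > 0"
      using assms by (intro Gamma_real_pos add_nonneg_pos) auto
    then show ?thesis by (simp add: c_def norm_divide norm_power)
  qed
  have sum_f: "summable (\<lambda>n. LINT x|lborel. norm (f n x))"
  proof (rule summable_comparison_test')
    show "summable (\<lambda>n. norm (c n))"
      unfolding norm_c using assms by (intro summable_power_over_sqrt_Gamma) auto
    show "norm (LINT x|lborel. norm (f n x)) \<le> norm (c n)" for n
    proof -
      have "(LINT x|lborel. norm (f n x)) =
          norm (c n) * (LINT x|lborel. \<bar>real_hermite_fn n x * real_hermite_fn m x\<bar>)"
        unfolding f_def norm_mult norm_of_real by simp
      also have "\<dots> \<le> norm (c n) * 1"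
        by (intro mult_left_mono integral_abs_real_hermite_fn_mult_le) simp
      finally show ?thesis by simp
    qed
  qed
  have AE_f: "AE x in lborel. summable (\<lambda>n. norm (f n x))"
    by (rule AE_summable_norm[OF int_f sum_f])
  \<comment> \<open>Where the Hermite function vanishes, the kernel series need not be known to converge:
    both sides are 0.\<close>
  have kernel: "cnj (MLB_kernel q z x) * hermite_fn m x = (\<Sum>n. f n x)"
    if "summable (\<lambda>n. norm (f n x))" for x
  proof (cases "real_hermite_fn m x = 0")
    case True
    then show ?thesis by (simp add: f_def hermite_fn_eq)
  next
    case False
    define k where "k n = cnj z ^ n / complex_of_real (sqrt (Gamma (q * real n + 1))) * hermite_fn n x" for n
    have f_k: "f n x = cnj (k n) * hermite_fn m x" for n
      by (simp add: f_def k_def c_def hermite_fn_eq)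
    have "summable (\<lambda>n. cnj (k n) * hermite_fn m x)"
      using summable_norm_cancel[OF that] by (simp add: f_k)
    \<comment> \<open>The nonzero factor \<open>hermite_fn m x\<close> cancels, so the kernel series
      itself converges at x and conjugation may pass through the sum.\<close>
    then have sum_k: "summable (\<lambda>n. cnj (k n))"
      using False by (subst (asm) mult.commute) (simp add: hermite_fn_eq summable_cmult_iff)
    have kernel_eq: "MLB_kernel q z x = (\<Sum>n. k n)"
      by (simp only: MLB_kernel_def k_def)
    have "cnj (\<Sum>n. k n) = (\<Sum>n. cnj (k n))"
      using sum_k by (metis complex_cnj_cnj sums_cnj sums_unique summable_sums)
    then show ?thesis
      using suminf_mult2[OF sum_k, of "hermite_fn m x"] kernel_eq by (simp add: f_k)
  qed
  have meas [measurable]: "hermite_fn n \<in> borel_measurable borel" for n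
    unfolding hermite_fn_eq[abs_def] by measurable
  have [measurable]: "MLB_kernel q z \<in> borel_measurable borel"
    unfolding MLB_kernel_def[abs_def] by measurable
  have "cnj \<in> borel_measurable borel"
    by (intro borel_measurable_continuous_onI continuous_intros)
  then have [measurable]: "(\<lambda>x. cnj (MLB_kernel q z x) * hermite_fn m x) \<in> borel_measurable borel"
    by measurable
  \<comment> \<open>The integrand is Borel, so completing the measure does not change its
    integral.\<close>
  have "MLB_transform q (hermite_fn m) z = (LINT x|lborel. cnj (MLB_kernel q z x) * hermite_fn m x)"
    unfolding MLB_transform_def by (rule integral_completion) simp
  also have "\<dots> = (LINT x|lborel. (\<Sum>n. f n x))"
  proof (rule integral_cong_AE)
    show "AE x in lborel. cnj (MLB_kernel q z x) * hermite_fn m x = (\<Sum>n. f n x)"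
      using AE_f by eventually_elim (rule kernel)
    show "(\<lambda>x. \<Sum>n. f n x) \<in> borel_measurable lborel"
      unfolding f_def by measurable
  qed simp
  also have "\<dots> = (\<Sum>n. LINT x|lborel. f n x)"
    by (rule integral_suminf[OF int_f AE_f sum_f])
  also have "\<dots> = (\<Sum>n. if n = m then c n else 0)"
    using f by (intro arg_cong[where f = suminf] ext) (auto simp: has_bochner_integral_iff)
  also have "\<dots> = c m"
    by (rule sums_unique[symmetric, OF sums_single])
  finally show ?thesis by (simp add: c_def)
qed

section \<open>Radial integration in the plane and the norm of a monomial\<close>

lemma distr_cmod_powr:
  fixes q :: real
  assumes "q > 0"
  shows "distr lborel borel (\<lambda>z. cmod z powr (2 / q)) =
    density lborel (\<lambda>t. ennreal (q * pi * t powr (q - 1)) * indicator {0..} t)" (is "?M = ?N")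
proof (rule measure_eqI_generator_eq)
  \<comment> \<open>Both measures are compared on the half-lines \<open>{..a}\<close>. For a \<ge> 0
    the preimage is the disc of radius a^(q/2), of area pi a^q, which is also the integral of q pi
    t^(q-1) over [0, a].\<close>
  let ?E = "range (\<lambda>a::real. {..a})"
  show "Int_stable ?E"
    by (auto simp: Int_stable_def)
  show "?E \<subseteq> Pow UNIV" by simp
  have emeasure_M: "emeasure ?M {..a} = (if a < 0 then 0 else ennreal (pi * a powr q))" for a
  proof -
    have "emeasure ?M {..a} = emeasure lborel {z. cmod z powr (2 / q) \<le> a}"
      by (subst emeasure_distr) (auto simp: vimage_def)
    also have "\<dots> = (if a < 0 then 0 else ennreal (pi * a powr q))"
    proof (cases "a < 0")
      case True
      then have "{z. cmod z powr (2 / q) \<le> a} = {}"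
        by (auto simp: not_le intro: less_le_trans)
      with True show ?thesis by simp
    next
      case False
      then have a: "(a powr (q / 2)) powr (2 / q) = a"
        using assms by (simp add: powr_powr)
      have "cmod z powr (2 / q) \<le> a \<longleftrightarrow> cmod z \<le> a powr (q / 2)" for z
      proof
        assume "cmod z \<le> a powr (q / 2)"
        then have "cmod z powr (2 / q) \<le> (a powr (q / 2)) powr (2 / q)"
          using assms by (intro powr_mono2) auto
        then show "cmod z powr (2 / q) \<le> a" unfolding a .
      next
        assume *: "cmod z powr (2 / q) \<le> a"
        show "cmod z \<le> a powr (q / 2)"
        proof (rule ccontr)
          assume "\<not> cmod z \<le> a powr (q / 2)"
          then have "(a powr (q / 2)) powr (2 / q) < cmod z powr (2 / q)"
            using assms by (intro powr_less_mono2) auto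
          with * show False unfolding a by linarith
        qed
      qed
      then have "{z. cmod z powr (2 / q) \<le> a} = cball 0 (a powr (q / 2))"
        by (intro set_eqI) (simp only: mem_Collect_eq mem_cball_0)
      moreover have "(a powr (q / 2))\<^sup>2 = a powr q"
        unfolding power2_eq_square powr_add[symmetric] by simp
      ultimately show ?thesis
        using False by (simp add: emeasure_cball unit_ball_vol_numeral)
    qed
    finally show ?thesis .
  qed
  have emeasure_N: "emeasure ?N {..a} = (if a < 0 then 0 else ennreal (pi * a powr q))" for a
  proof -
    have "emeasure ?N {..a} = (\<integral>\<^sup>+t. ennreal (q * pi * t powr (q - 1)) * indicator {0..} t * indicator {..a} t \<partial>lborel)"
      by (rule emeasure_density) auto
    also have "\<dots> = (\<integral>\<^sup>+t. ennreal (q * pi * t powr (q - 1)) * indicator {0..a} t \<partial>lborel)"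
      by (intro nn_integral_cong) (simp split: split_indicator)
    also have "\<dots> = (if a < 0 then 0 else ennreal (pi * a powr q))"
    proof (cases "a < 0")
      case False
      then have "((\<lambda>t. q * pi * t powr (q - 1)) has_integral q * pi * (a powr (q - 1 + 1) / (q - 1 + 1))) {0..a}"
        using assms by (intro has_integral_mult_right has_integral_powr_from_0) auto
      then have "((\<lambda>t. q * pi * t powr (q - 1)) has_integral pi * a powr q) {0..a}"
        using assms by simp
      from nn_integral_has_integral_lebesgue'[OF _ this] show ?thesis
        using False assms by simp
    qed auto
    finally show ?thesis .
  qed
  show "emeasure ?M X = emeasure ?N X" if "X \<in> ?E" for X
    using that emeasure_M emeasure_N by auto
  show "sets ?M = sigma_sets UNIV ?E" "sets ?N = sigma_sets UNIV ?E"
    by (simp_all add: borel_eq_atMost)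
  show "range (\<lambda>i::nat. {..real i}) \<subseteq> ?E" by auto
  show "(\<Union>i::nat. {..real i}) = UNIV"
    by (auto simp: real_arch_simple)
  show "emeasure ?M {..real i} \<noteq> \<infinity>" for i :: nat
    by (simp add: emeasure_M)
qed

text \<open>Change of variables t = |z|^(2/q). Working with the nonnegative integral lets
  integrability and value be obtained together.\<close>

lemma nn_integral_cmod_powr:
  fixes q :: real and g :: "real \<Rightarrow> real"
  assumes "q > 0" and [measurable]: "g \<in> borel_measurable borel" and "\<And>t. t \<ge> 0 \<Longrightarrow> g t \<ge> 0"
  shows "(\<integral>\<^sup>+z. ennreal (g (cmod z powr (2 / q))) \<partial>lborel) =
    (\<integral>\<^sup>+t. ennreal (q * pi * t powr (q - 1) * g t) * indicator {0..} t \<partial>lborel)"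
proof -
  have "(\<integral>\<^sup>+z. ennreal (g (cmod z powr (2 / q))) \<partial>lborel) =
      (\<integral>\<^sup>+t. ennreal (g t) \<partial>distr lborel borel (\<lambda>z. cmod z powr (2 / q)))"
    by (rule nn_integral_distr[symmetric]) auto
  also have "\<dots> = (\<integral>\<^sup>+t. ennreal (q * pi * t powr (q - 1)) * indicator {0..} t * ennreal (g t) \<partial>lborel)"
    unfolding distr_cmod_powr[OF assms(1)] by (rule nn_integral_density) auto
  also have "\<dots> = (\<integral>\<^sup>+t. ennreal (q * pi * t powr (q - 1) * g t) * indicator {0..} t \<partial>lborel)"
  proof (rule nn_integral_cong)
    fix t :: real
    show "ennreal (q * pi * t powr (q - 1)) * indicator {0..} t * ennreal (g t) =
        ennreal (q * pi * t powr (q - 1) * g t) * indicator {0..} t"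
    proof (cases "t \<ge> 0")
      case True
      then have "ennreal (q * pi * t powr (q - 1) * g t) = ennreal (q * pi * t powr (q - 1)) * ennreal (g t)"
        using assms by (intro ennreal_mult') simp
      with True show ?thesis
        by (simp only: indicator_simps atLeast_iff mult_1_right)
    qed simp
  qed
  finally show ?thesis .
qed

lemma has_bochner_integral_monomial_MLF_weight:
  fixes q :: real
  assumes "q > 0"
  shows "has_bochner_integral lborel (\<lambda>z. (cmod (z ^ m))\<^sup>2 * MLF_weight q z)
    (q * pi * Gamma (q * real m + 1))"
proof (rule has_bochner_integral_nn_integral)
  have pos: "q * real m + 1 > 0"
    using assms by (intro add_nonneg_pos) auto
  \<comment> \<open>With t = |z|^(2/q), the factor |z|^(2m) |z|^(2/q - 2) becomes t^(qm + 1 - q).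
    The density t^(q-1) then leaves t^(qm), the integrand of Gamma at qm + 1.\<close>
  let ?g = "\<lambda>t::real. t powr (q * real m + 1 - q) * exp (- t)"
  have eq: "(cmod (z ^ m))\<^sup>2 * MLF_weight q z = ?g (cmod z powr (2 / q))" for z
  \<comment> \<open>Natural powers and \<open>powr\<close> disagree at base 0 and exponent 0, so the
    origin is treated apart; both sides vanish there because \<open>0 powr a = 0\<close>.\<close>
  proof (cases "z = 0")
    case False
    have "(cmod (z ^ m))\<^sup>2 = cmod z ^ (m * 2)"
      by (simp only: norm_power power_mult)
    also have "\<dots> = cmod z powr real (m * 2)"
      using False by (intro powr_realpow[symmetric]) simp
    also have "real (m * 2) = 2 * real m"
      by simp
    finally have "(cmod (z ^ m))\<^sup>2 * cmod z powr (2 / q - 2) = cmod z powr (2 * real m + (2 / q - 2))"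
      by (simp only: powr_add)
    also have "2 * real m + (2 / q - 2) = 2 / q * (q * real m + 1 - q)"
      using assms by (simp add: field_simps)
    finally show ?thesis
      by (simp only: MLF_weight_def powr_powr mult.assoc[symmetric])
  qed (simp add: MLF_weight_def)
  have "(\<integral>\<^sup>+z. ennreal ((cmod (z ^ m))\<^sup>2 * MLF_weight q z) \<partial>lborel) =
      (\<integral>\<^sup>+t. ennreal (q * pi * t powr (q - 1) * ?g t) * indicator {0..} t \<partial>lborel)"
    unfolding eq using assms by (intro nn_integral_cmod_powr) auto
  also have "\<dots> = ennreal (q * pi * Gamma (q * real m + 1))"
  proof (rule nn_integral_has_integral_lebesgue')
    have "((\<lambda>t. q * pi * (t powr (q * real m + 1 - 1) / exp t)) has_integral
        q * pi * Gamma (q * real m + 1)) {0..}"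
      by (intro has_integral_mult_right Gamma_integral_real pos)
    moreover have "q * pi * (t powr (q * real m + 1 - 1) / exp t) = q * pi * t powr (q - 1) * ?g t" for t
    proof -
      have "t powr (q * real m + 1 - 1) = t powr (q - 1) * t powr (q * real m + 1 - q)"
        unfolding powr_add[symmetric] by simp
      then show ?thesis
        by (simp only: exp_minus divide_inverse mult.assoc)
    qed
    ultimately show "((\<lambda>t. q * pi * t powr (q - 1) * ?g t) has_integral
        q * pi * Gamma (q * real m + 1)) {0..}"
      by simp
  qed (use assms in auto)
  finally show "(\<integral>\<^sup>+z. ennreal ((cmod (z ^ m))\<^sup>2 * MLF_weight q z) \<partial>lborel) =
      ennreal (q * pi * Gamma (q * real m + 1))" .
  show "0 \<le> q * pi * Gamma (q * real m + 1)"
    using assms Gamma_real_pos[OF pos] by simp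
qed (auto simp: MLF_weight_def)

section \<open>Membership in the two spaces and the unit norms\<close>

theorem lemma3p5:
  fixes q :: real and m :: nat
  assumes "q > 0"
  shows "(\<forall>z. MLB_transform q (hermite_fn m) z =
            z ^ m / complex_of_real (sqrt (Gamma (q * real m + 1)))) \<and>
         MLB_transform q (hermite_fn m) \<in> MLF_space q \<and>
         hermite_fn m \<in> L2_space \<and>
         MLF_norm q (MLB_transform q (hermite_fn m)) = 1 \<and>
         L2_norm (hermite_fn m) = 1"
proof (intro conjI allI)
  define G where "G = Gamma (q * real m + 1)"
  have "G > 0"
    unfolding G_def using assms by (intro Gamma_real_pos add_nonneg_pos) auto
  show "MLB_transform q (hermite_fn m) z =
      z ^ m / complex_of_real (sqrt (Gamma (q * real m + 1)))" for z
    by (rule MLB_transform_hermite_fn[OF assms])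
  then have B: "MLB_transform q (hermite_fn m) = (\<lambda>z. z ^ m / complex_of_real (sqrt G))"
    by (auto simp: G_def)
  \<comment> \<open>The factor 1/G is the squared modulus of the coefficient 1/sqrt(G). It reduces
    the integral to q pi, which the normalisation in \<open>MLF_norm\<close> cancels.\<close>
  have "has_bochner_integral lborel (\<lambda>z. 1 / G * ((cmod (z ^ m))\<^sup>2 * MLF_weight q z)) (1 / G * (q * pi * G))"
    unfolding G_def by (intro has_bochner_integral_mult_right has_bochner_integral_monomial_MLF_weight assms)
  also have "(\<lambda>z. 1 / G * ((cmod (z ^ m))\<^sup>2 * MLF_weight q z)) =
      (\<lambda>z. (cmod (z ^ m / complex_of_real (sqrt G)))\<^sup>2 * MLF_weight q z)"
    using \<open>G > 0\<close> by (simp add: norm_divide power_divide)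
  finally have int: "has_bochner_integral lborel
      (\<lambda>z. (cmod (z ^ m / complex_of_real (sqrt G)))\<^sup>2 * MLF_weight q z) (q * pi)"
    using \<open>G > 0\<close> by simp
  have [measurable]: "(\<lambda>z. (cmod (z ^ m / complex_of_real (sqrt G)))\<^sup>2 * MLF_weight q z)
      \<in> borel_measurable lborel"
    using int by (auto simp: has_bochner_integral_iff)
  show "MLB_transform q (hermite_fn m) \<in> MLF_space q"
    unfolding MLF_space_def B using int \<open>G > 0\<close>
    by (auto simp: integrable_completion has_bochner_integral_iff intro!: holomorphic_intros)
  show "MLF_norm q (MLB_transform q (hermite_fn m)) = 1"
    unfolding MLF_norm_def B using int assms
    by (simp add: integral_completion has_bochner_integral_iff)
  have int2: "has_bochner_integral lborel (\<lambda>x. (cmod (hermite_fn m x))\<^sup>2) 1"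
    using real_hermite_fn_orthonormal[of m m] by (simp add: hermite_fn_eq power2_eq_square)
  have [measurable]: "hermite_fn m \<in> borel_measurable borel"
    unfolding hermite_fn_eq[abs_def] by measurable
  show "hermite_fn m \<in> L2_space"
    unfolding L2_space_def using int2
    by (auto simp: integrable_completion has_bochner_integral_iff intro!: measurable_completion)
  have "L2_inner (hermite_fn m) (hermite_fn m) = complex_of_real (LINT x|lborel. (cmod (hermite_fn m x))\<^sup>2)"
    unfolding L2_inner_def
    unfolding complex_norm_square[symmetric] integral_complex_of_real[symmetric]
    by (rule integral_completion) measurable
  then show "L2_norm (hermite_fn m) = 1"
    using int2 by (simp add: L2_norm_def has_bochner_integral_iff)
qed

end
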